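(* Let $q$ be a prime power and $\mathbb{A}=\mathbb{F}_q[t]$. The natural density of Chen pairs $(g,g)$, that is, the limit $$\rho=\lim_{m\to\infty}\frac{\#\{g\in\mathbb{A}:\ 1\le\deg g\le m,\ (g,g)\text{ is a Chen pair}\}}{\#\{g\in\mathbb{A}:\ 1\le\deg g\le m\}},$$ exists and is given by $\rho=\frac{49}{72}$ if $q=2$, and $\rho=\frac{q-1}{q}$ if $q>2$.
   Context: $\mathbb{F}_q$ is the finite field with $q$ elements and $\mathbb{A}=\mathbb{F}_q[t]$. For a non-constant $f\in\mathbb{A}$, $\mathbb{A}_f=\mathbb{A}/f\mathbb{A}$ is the residue class ring modulo $f$, and $\mathcal{A}_f=\{h\in\mathbb{A}:\deg h<\deg f\}\cup\{0\}$, a complete set of representatives of the residue classes modulo $f$; for $h\in\mathcal{A}_f$, $\bar h$ denotes the residue class of $h$ modulo $f$. Let $f,g\in\mathbb{A}$ be non-constant. A function $\sigma:\mathbb{A}_f\to\mathbb{A}_g$ is a polynomial function if there is $F\in\mathbb{A}[x]$ such that $\sigma(\bar h)=F(h)\bmod g$ for all $h\in\mathcal{A}_f$. A function $\sigma:\mathbb{A}_f\to\mathbb{A}_g$ is called congruence preserving if for all $h_1,h_2\in\mathcal{A}_f$ and every $h\in\mathbb{A}$ dividing $g$, $h_1\equiv h_2\pmod h$ implies $\sigma(\bar h_1)\equiv\sigma(\bar h_2)\pmod h$ (here $h_1,h_2$ are regarded as elements of $\mathbb{A}$, and reduction modulo $h$ of elements of $\mathbb{A}_g$ is well defined since $h\mid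 g$). $(f,g)$ is a Chen pair if every congruence preserving function from $\mathbb{A}_f$ to $\mathbb{A}_g$ is a polynomial function. *)

theory Defs
  imports
    Complex_Main
    "HOL-Library.Cardinality"
    "HOL-Computational_Algebra.Polynomial"
    "HOL-Number_Theory.Cong"
begin

text \<open>
  Polynomials over a finite field are modelled by the type \<open>'a poly\<close> with
  \<open>'a :: {finite, field}\<close>. The set underlying the residue class ring modulo \<open>f\<close>
  is the quotient of all polynomials by congruence modulo \<open>f\<close>, so residue classes
  are sets of polynomials.
\<close>

definition cong_rel :: "'a::field poly \<Rightarrow> ('a poly \<times> 'a poly) set" where
  "cong_rel f = {(a, b). [a = b] (mod f)}"

definition residue_class :: "'a::field poly \<Rightarrow> 'a poly \<Rightarrow> 'a poly set" where
  "residue_class f h = cong_rel f `` {h}"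

definition residue_classes :: "'a::field poly \<Rightarrow> 'a poly set set" where
  "residue_classes f = UNIV // cong_rel f"

definition representatives :: "'a::field poly \<Rightarrow> 'a poly set" where
  "representatives f = {h. degree h < degree f} \<union> {0}"

text \<open>
  Reduction modulo \<open>h\<close> of a residue class modulo \<open>g\<close>. If \<open>h\<close> divides \<open>g\<close>, all members
  \<open>c\<close> of \<open>C\<close> have the same residue class modulo \<open>h\<close>, so the union is that single class.
\<close>

definition reduce :: "'a::field poly \<Rightarrow> 'a poly set \<Rightarrow> 'a poly set" where
  "reduce h C = (\<Union>c\<in>C. residue_class h c)"

definition polynomial_function ::
  "'a::field poly \<Rightarrow> 'a poly \<Rightarrow> ('a poly set \<Rightarrow> 'a poly set) \<Rightarrow> bool" where
  "polynomial_function f g \<sigma> \<longleftrightarrow>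
     (\<exists>F :: 'a poly poly. \<forall>h\<in>representatives f.
        \<sigma> (residue_class f h) = residue_class g (poly F h))"

definition congruence_preserving ::
  "'a::field poly \<Rightarrow> 'a poly \<Rightarrow> ('a poly set \<Rightarrow> 'a poly set) \<Rightarrow> bool" where
  "congruence_preserving f g \<sigma> \<longleftrightarrow>
     (\<forall>h\<^sub>1\<in>representatives f. \<forall>h\<^sub>2\<in>representatives f. \<forall>h. h dvd g \<longrightarrow>
        [h\<^sub>1 = h\<^sub>2] (mod h) \<longrightarrow>
        reduce h (\<sigma> (residue_class f h\<^sub>1)) = reduce h (\<sigma> (residue_class f h\<^sub>2)))"

definition Chen_pair :: "'a::field poly \<Rightarrow> 'a poly \<Rightarrow> bool" where
  "Chen_pair f g \<longleftrightarrow>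
     (\<forall>\<sigma>. (\<forall>C\<in>residue_classes f. \<sigma> C \<in> residue_classes g) \<longrightarrow>
        congruence_preserving f g \<sigma> \<longrightarrow> polynomial_function f g \<sigma>)"

end

theory Submission
  imports Defs
    "HOL-Computational_Algebra.Polynomial_Factorial"
    "HOL-Computational_Algebra.Squarefree"
begin

text \<open>
  \<open>(g, g)\<close> is a Chen pair iff \<open>p\<^sup>2\<close> divides \<open>g\<close> only for primes \<open>p\<close> with residue field of
  order \<open>2\<close>, and \<open>p\<^sup>3\<close> for no prime \<open>p\<close>. By the Chinese remainder theorem sufficiency reduces
  to \<open>g = p\<close>, where Lagrange interpolation applies, and to \<open>g = p\<^sup>2\<close> with four residue
  classes, where a cubic polynomial interpolates. For necessity, let \<open>p\<^sup>e\<close> exactly divide \<open>g\<close>: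
  every polynomial \<open>F\<close> satisfies \<open>x y dvd F (x + y) - F x - F y + F 0\<close>, which the
  congruence preserving map sending multiples of \<open>p\<^sup>e\<close> to \<open>g / p\<close> and the rest to \<open>0\<close> violates,
  for \<open>x = p\<^sup>e\<^sup>-\<^sup>2\<close>, \<open>y = p\<^sup>e\<^sup>-\<^sup>1\<close> if \<open>e \<ge> 3\<close>, and for \<open>x = p\<close>, \<open>y = k p\<close> with
  \<open>k\<close> and \<open>1 + k\<close> prime to \<open>p\<close> if \<open>e = 2\<close>.

  So for \<open>q > 2\<close> the Chen pairs are the squarefree \<open>g\<close>, which unique factorisation \<open>g = a b\<^sup>2\<close> with
  \<open>a\<close> squarefree and \<open>b\<close> monic counts exactly. For \<open>q = 2\<close> the conditions at the two linear
  primes are relaxed from \<open>p\<^sup>2\<close> to \<open>p\<^sup>3\<close>, each of which multiplies the density \<open>1 / 2\<close> by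
  \<open>(1 - 1 / 8) / (1 - 1 / 4) = 7 / 6\<close>.
\<close>

section \<open>Arithmetic of polynomials over a field\<close>

text \<open>Euclidean algorithm: a combination of \<open>b\<close> and \<open>a mod b\<close> that
  divides both also divides \<open>a\<close>, and substituting
  \<open>a mod b = a - (a div b) * b\<close> turns it into a combination of \<open>a\<close> and
  \<open>b\<close>.\<close>

lemma euclidean_ring_bezout:
  fixes a b :: "'a :: euclidean_ring"
  shows "\<exists>x y. x * a + y * b dvd a \<and> x * a + y * b dvd b"
proof (induction "euclidean_size b" arbitrary: a b rule: less_induct)
  case less
  show ?case
  proof (cases "b = 0")
    case True
    have "1 * a + 0 * b dvd a \<and> 1 * a + 0 * b dvd b"
      using True by simp
    then show ?thesis by blast
  next
    case False
    then have "euclidean_size (a mod b) < euclidean_size b"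
      by (rule mod_size_less)
    from less[OF this] obtain x y
      where d: "x * b + y * (a mod b) dvd b" "x * b + y * (a mod b) dvd a mod b"
      by blast
    then have "x * b + y * (a mod b) dvd a"
      using dvd_mod_iff by blast
    moreover have "x * b + y * (a mod b) = y * a + (x - y * (a div b)) * b"
    proof -
      have ab: "a mod b = a - (a div b) * b"
        by (simp add: minus_div_mult_eq_mod)
      show ?thesis unfolding ab by (simp add: algebra_simps)
    qed
    ultimately show ?thesis using d(1) by metis
  qed
qed

lemma prime_elem_bezout:
  fixes p b :: "'a :: euclidean_ring"
  assumes "prime_elem p" "\<not> p dvd b"
  shows "\<exists>x y. x * p + y * b = 1"
proof -
  obtain x y where d: "x * p + y * b dvd p" "x * p + y * b dvd b"
    using euclidean_ring_bezout by blast
  have "is_unit (x * p + y * b)"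
    using prime_elem_imp_irreducible[OF assms(1)] d assms(2)
    by (meson dvd_trans irreducibleD')
  then obtain u where "1 = (x * p + y * b) * u" by (rule dvdE)
  then have "(u * x) * p + (u * y) * b = 1" by (simp add: algebra_simps)
  then show ?thesis by blast
qed

text \<open>Multiply the identity for \<open>p ^ k\<close> by the one for \<open>p\<close>: every
  product other than \<open>x * p ^ k * (u * p)\<close> contains \<open>b\<close>.\<close>

lemma prime_elem_power_bezout:
  fixes p b :: "'a :: euclidean_ring"
  assumes "prime_elem p" "\<not> p dvd b"
  shows "\<exists>x y. x * p ^ k + y * b = 1"
proof (induction k)
  case 0
  have "1 * p ^ 0 + 0 * b = 1" by simp
  then show ?case by blast
next
  case (Suc k)
  then obtain x y where 1: "x * p ^ k + y * b = 1" by blast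
  obtain u v where 2: "u * p + v * b = 1"
    using prime_elem_bezout[OF assms] by blast
  have "1 = (x * p ^ k + y * b) * (u * p + v * b)" using 1 2 by simp
  also have "\<dots> = (x * u) * p ^ Suc k + (x * p ^ k * v + y * u * p + y * v * b) * b"
    by (simp add: algebra_simps)
  finally have "(x * u) * p ^ Suc k + (x * p ^ k * v + y * u * p + y * v * b) * b = 1" ..
  then show ?case by blast
qed

lemma prime_elem_degree_pos:
  fixes p :: "'a :: field poly"
  assumes "prime_elem p"
  shows "degree p > 0"
  using assms is_unit_iff_degree[of p] by auto

lemma exists_prime_elem_dvd:
  fixes g :: "'a :: field poly"
  assumes "degree g > 0"
  shows "\<exists>p. prime_elem p \<and> p dvd g"
  using assms
proof (induction "degree g" arbitrary: g rule: less_induct)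
  case less
  show ?case
  proof (cases "irreducible g")
    case True
    then have "prime_elem g" by (rule field_poly_irreducible_imp_prime)
    then show ?thesis using dvd_refl by auto
  next
    case False
    from less.prems have g: "g \<noteq> 0" by auto
    with less.prems have "\<not> is_unit g" by (simp add: is_unit_iff_degree)
    with False g obtain a b where ab: "g = a * b" "\<not> is_unit a" "\<not> is_unit b"
      unfolding irreducible_def by auto
    have "a \<noteq> 0" "b \<noteq> 0" using g ab(1) by auto
    then have "degree a > 0" "degree a < degree g"
      using ab by (simp_all add: degree_mult_eq is_unit_iff_degree)
    from less.hyps[OF this(2,1)] obtain p where p: "prime_elem p" "p dvd a" by auto
    from p(2) have "p dvd g" unfolding ab(1) by (rule dvd_mult2)
    with p(1) show ?thesis by auto
  qed
qed

lemma split_prime_power: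
  fixes g p :: "'a :: field poly"
  assumes "g \<noteq> 0" "degree p > 0"
  obtains e b where "g = p ^ e * b" "\<not> p dvd b"
proof -
  have "\<exists>e b. g = p ^ e * b \<and> \<not> p dvd b"
    using assms(1)
  proof (induction "degree g" arbitrary: g rule: less_induct)
    case less
    show ?case
    proof (cases "p dvd g")
      case False
      then have "g = p ^ 0 * g \<and> \<not> p dvd g" by simp
      then show ?thesis by blast
    next
      case True
      then obtain h where h: "g = p * h" by (rule dvdE)
      with less.prems assms(2) have "h \<noteq> 0" "degree h < degree g"
        by (auto simp: degree_mult_eq)
      with less.hyps obtain e b where "h = p ^ e * b" "\<not> p dvd b" by blast
      with h have "g = p ^ Suc e * b \<and> \<not> p dvd b" by (simp add: mult.assoc)
      then show ?thesis by blast
    qed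
  qed
  with that show ?thesis by blast
qed

lemma squarefree_iff_prime_elem:
  fixes g :: "'a :: field poly"
  shows "squarefree g \<longleftrightarrow> g \<noteq> 0 \<and> (\<forall>p. prime_elem p \<longrightarrow> \<not> p ^ 2 dvd g)"
proof (intro iffI conjI allI impI)
  assume "g \<noteq> 0 \<and> (\<forall>p. prime_elem p \<longrightarrow> \<not> p ^ 2 dvd g)"
  then have g: "g \<noteq> 0" "\<And>p. prime_elem p \<Longrightarrow> \<not> p ^ 2 dvd g" by blast+
  show "squarefree g"
  proof (rule squarefreeI, rule ccontr)
    fix x assume x: "x ^ 2 dvd g" "\<not> is_unit x"
    with g(1) have "x \<noteq> 0" by auto
    with x(2) have "degree x > 0" using is_unit_iff_degree by auto
    then obtain p where "prime_elem p" "p dvd x" using exists_prime_elem_dvd by blast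
    with x(1) g(2) show False by (meson dvd_trans dvd_power_same)
  qed
qed (auto dest: squarefreeD prime_elem_not_unit)

section \<open>Polynomial interpolation of congruence preserving maps\<close>

text \<open>Congruence preservation for a lift of the map to all polynomials; the divisor
  \<open>d = g\<close> makes the lift well defined on residue classes modulo
  \<open>g\<close>.\<close>

definition compatible :: "'a :: field poly \<Rightarrow> ('a poly \<Rightarrow> 'a poly) \<Rightarrow> bool" where
  "compatible g s \<longleftrightarrow>
     (\<forall>d x y. d dvd g \<longrightarrow> [x = y] (mod d) \<longrightarrow> [s x = s y] (mod d))"

text \<open>For \<open>g \<noteq> 0\<close> this is the Chen property of \<open>(g, g)\<close>,
  phrased with lifts in place of maps on residue classes.\<close>

definition interpolable :: "'a :: field poly \<Rightarrow> bool" where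
  "interpolable g \<longleftrightarrow>
     (\<forall>s. compatible g s \<longrightarrow> (\<exists>F :: 'a poly poly. \<forall>x. [s x = poly F x] (mod g)))"

lemma compatible_dvd: "compatible g s \<Longrightarrow> d dvd g \<Longrightarrow> compatible d s"
  unfolding compatible_def by (meson dvd_trans)

lemma compatibleD: "compatible g s \<Longrightarrow> d dvd g \<Longrightarrow> [x = y] (mod d) \<Longrightarrow> [s x = s y] (mod d)"
  unfolding compatible_def by blast

lemma poly_cong:
  fixes x y m :: "'a :: field poly"
  assumes "[x = y] (mod m)"
  shows "[poly F x = poly F y] (mod m)"
  by (induction F) (auto intro!: cong_add cong_mult assms)

lemma interpolable_unit: "is_unit g \<Longrightarrow> interpolable g"
  unfolding interpolable_def
  by (metis cong_iff_dvd_diff unit_imp_dvd)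

text \<open>By \<open>bez\<close>, \<open>y * b\<close> is \<open>1\<close> modulo \<open>a\<close>
  and \<open>0\<close> modulo \<open>b\<close>, and \<open>x * a\<close> the reverse, so these two
  weights glue the interpolants modulo \<open>a\<close> and \<open>b\<close>.\<close>

lemma interpolable_mult:
  fixes a b :: "'a :: field poly"
  assumes "interpolable a" "interpolable b" and bez: "x * a + y * b = 1"
  shows "interpolable (a * b)"
  unfolding interpolable_def
proof (intro allI impI)
  fix s assume s: "compatible (a * b) s"
  obtain F where F: "\<And>h. [s h = poly F h] (mod a)"
    using assms(1) compatible_dvd[OF s, of a] unfolding interpolable_def by auto
  obtain G where G: "\<And>h. [s h = poly G h] (mod b)"
    using assms(2) compatible_dvd[OF s, of b] unfolding interpolable_def by auto
  have "[s h = poly (smult (y * b) F + smult (x * a) G) h] (mod (a * b))" for h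
  proof -
    obtain u where u: "s h - poly F h = a * u"
      using F[of h] unfolding cong_iff_dvd_diff by (rule dvdE)
    obtain v where v: "s h - poly G h = b * v"
      using G[of h] unfolding cong_iff_dvd_diff by (rule dvdE)
    have "s h - poly (smult (y * b) F + smult (x * a) G) h
        = (x * a + y * b) * s h - (y * b * poly F h + x * a * poly G h)"
      using bez by simp
    also have "\<dots> = y * b * (s h - poly F h) + x * a * (s h - poly G h)"
      by (simp add: algebra_simps)
    also have "\<dots> = a * b * (y * u + x * v)"
      unfolding u v by (simp add: algebra_simps)
    finally show ?thesis unfolding cong_iff_dvd_diff by simp
  qed
  then show "\<exists>F. \<forall>h. [s h = poly F h] (mod (a * b))" by blast
qed

text \<open>Newton interpolation, one node at a time: a multiple of the product \<open>P\<close>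
  over the old nodes corrects the value at the new node \<open>r\<close>, as \<open>poly P r\<close>
  is invertible modulo \<open>p\<close>.\<close>

lemma interpolation_mod_prime:
  fixes p :: "'a :: field poly"
  assumes p: "prime_elem p" and "finite S"
    and inc: "\<And>x y. x \<in> S \<Longrightarrow> y \<in> S \<Longrightarrow> [x = y] (mod p) \<Longrightarrow> x = y"
  shows "\<exists>F. \<forall>x\<in>S. [s x = poly F x] (mod p)"
  using \<open>finite S\<close> inc
proof (induction S rule: finite_induct)
  case empty
  then show ?case by simp
next
  case (insert r S)
  then obtain F where F: "\<And>x. x \<in> S \<Longrightarrow> [s x = poly F x] (mod p)" by auto
  define P where "P = (\<Prod>x\<in>S. [:- x, 1:])"
  have P: "poly P z = (\<Prod>x\<in>S. z - x)" for z
    by (simp add: P_def poly_prod)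
  have "\<not> p dvd r - x" if "x \<in> S" for x
    using insert.prems[of r x] insert.hyps that by (auto simp: cong_iff_dvd_diff)
  with insert.hyps(1) have "\<not> p dvd (\<Prod>x\<in>S. r - x)"
    by (induction S rule: finite_induct)
      (use p in \<open>auto simp: prime_elem_dvd_mult_iff prime_elem_not_unit\<close>)
  then have "\<not> p dvd poly P r" by (simp only: P not_False_eq_True)
  then obtain u v where uv: "u * p + v * poly P r = 1"
    using prime_elem_bezout[OF p] by blast
  define G where "G = F + smult ((s r - poly F r) * v) P"
  have "[s x = poly G x] (mod p)" if "x \<in> insert r S" for x
  proof (cases "x = r")
    case True
    have "s r - poly G r = (s r - poly F r) * (1 - v * poly P r)"
      by (simp add: G_def algebra_simps)
    also have "1 - v * poly P r = u * p" using uv by (simp add: algebra_simps)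
    finally show ?thesis using True by (simp add: cong_iff_dvd_diff)
  next
    case False
    with that have "x \<in> S" by simp
    then have "poly P x = 0" unfolding P using insert.hyps(1) by auto
    with F[OF \<open>x \<in> S\<close>] show ?thesis by (simp add: G_def)
  qed
  then show ?case by blast
qed

lemma card_degree_le: "card {g :: 'a :: {finite, field} poly. degree g \<le> n} = CARD('a) ^ Suc n"
proof (induction n)
  case 0
  have "{g :: 'a poly. degree g \<le> 0} = (\<lambda>c. [:c:]) ` UNIV"
    by (auto elim: degree_eq_zeroE)
  moreover have "inj (\<lambda>c :: 'a. [:c:])" by (simp add: inj_def)
  ultimately show ?case by (simp add: card_image)
next
  case (Suc n)
  have eq: "{g :: 'a poly. degree g \<le> Suc n} =
      (\<lambda>(c, g). pCons c g) ` (UNIV \<times> {g. degree g \<le> n})"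
  proof (intro equalityI subsetI)
    fix g :: "'a poly" assume g: "g \<in> {g. degree g \<le> Suc n}"
    obtain c h where "g = pCons c h" by (rule pCons_cases)
    with g have "(c, h) \<in> UNIV \<times> {g. degree g \<le> n}" by (auto split: if_splits)
    with \<open>g = pCons c h\<close> show "g \<in> (\<lambda>(c, g). pCons c g) ` (UNIV \<times> {g. degree g \<le> n})"
      by force
  qed auto
  have "inj_on (\<lambda>(c, g). pCons c g) (UNIV \<times> {g :: 'a poly. degree g \<le> n})"
    by (auto simp: inj_on_def)
  then show ?case unfolding eq using Suc by (simp add: card_image card_cartesian_product)
qed

lemma finite_degree_le: "finite {g :: 'a :: {finite, field} poly. degree g \<le> n}"
  by (rule card_ge_0_finite) (simp add: card_degree_le)

text \<open>The remainders \<open>x mod p\<close> are finitely many and pairwise incongruent, so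
  they serve as nodes; \<open>s\<close> and \<open>poly F\<close> both depend only on the class of
  \<open>x\<close>.\<close>

lemma interpolable_prime_elem:
  fixes p :: "'a :: {finite, field} poly"
  assumes p: "prime_elem p"
  shows "interpolable p"
  unfolding interpolable_def
proof (intro allI impI)
  fix s assume s: "compatible p s"
  have "p \<noteq> 0" using p by auto
  then have "degree (x mod p) \<le> degree p" for x
    using degree_mod_less[of p x] by auto
  then have "range (\<lambda>x. x mod p) \<subseteq> {g. degree g \<le> degree p}" by blast
  then have fin: "finite (range (\<lambda>x. x mod p))" by (rule finite_subset) (rule finite_degree_le)
  have "\<exists>F. \<forall>x\<in>range (\<lambda>x. x mod p). [s x = poly F x] (mod p)"
    by (rule interpolation_mod_prime[OF p fin]) (auto simp: cong_def)
  then obtain F where F: "\<And>x. [s (x mod p) = poly F (x mod p)] (mod p)" by blast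
  have "[s x = poly F x] (mod p)" for x
  proof -
    have "[s x = s (x mod p)] (mod p)"
      by (rule compatibleD[OF s]) (auto simp: cong_def)
    also note F
    also have "[poly F (x mod p) = poly F x] (mod p)"
      by (rule poly_cong) (auto simp: cong_def)
    finally show ?thesis .
  qed
  then show "\<exists>F. \<forall>x. [s x = poly F x] (mod p)" by blast
qed

lemma UNIV_eq_0_1:
  assumes "CARD('a :: {finite, field}) = 2"
  shows "(UNIV :: 'a set) = {0, 1}"
proof -
  have "card {0, 1 :: 'a} = 2" by simp
  then show ?thesis using assms card_subset_eq[of "UNIV :: 'a set" "{0, 1}"] by auto
qed

lemma mod_linear_cases:
  fixes p :: "'a :: {finite, field} poly"
  assumes "CARD('a) = 2" "degree p = 1"
  shows "x mod p \<in> {0, 1}"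
proof -
  have "degree (x mod p) = 0"
    using degree_mod_less[of p x] assms(2) by (cases "p = 0") auto
  then obtain c where "x mod p = [:c:]" by (rule degree_eq_zeroE)
  moreover have "c = 0 \<or> c = 1" using UNIV_eq_0_1[OF assms(1)] by blast
  ultimately show ?thesis by auto
qed

text \<open>
  Modulo \<open>p\<^sup>2\<close> the representatives are \<open>0, 1, p, 1 + p\<close>. The products \<open>x (x - 1)\<close> and
  \<open>x\<^sup>2 (x - 1)\<close> vanish at \<open>0\<close> and \<open>1\<close>; modulo \<open>p\<^sup>2\<close> they equal \<open>-p\<close> and \<open>0\<close> at \<open>p\<close>,
  and both equal \<open>p\<close> at \<open>1 + p\<close>.
\<close>

lemma interpolable_linear_square:
  fixes p :: "'a :: {finite, field} poly"
  assumes q: "CARD('a) = 2" and p: "degree p = 1"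
  shows "interpolable (p ^ 2)"
  unfolding interpolable_def
proof (intro allI impI)
  fix s assume s: "compatible (p ^ 2) s"
  have "[s p = s 0] (mod p)"
    by (rule compatibleD[OF s]) (auto simp: cong_iff_dvd_diff)
  then obtain a where a: "s p - s 0 = p * a" unfolding cong_iff_dvd_diff by (rule dvdE)
  have "[s (1 + p) = s 1] (mod p)"
    by (rule compatibleD[OF s]) (auto simp: cong_iff_dvd_diff)
  then obtain b where b: "s (1 + p) - s 1 = p * b" unfolding cong_iff_dvd_diff by (rule dvdE)
  define d where "d = s 1 - s 0"
  \<comment> \<open>Modulo \<open>p ^ 2\<close>, the value at \<open>p\<close> demands
    \<open>d * p - A * p = a * p\<close>, and the value at \<open>1 + p\<close> demands
    \<open>d * p + A * p + B * p = b * p\<close>.\<close>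
  define A where "A = d - a"
  define B where "B = b - d - A"
  define F where "F = [:s 0, d - A, A - B, B:]"
  have F: "poly F x = s 0 + d * x + A * (x * (x - 1)) + B * (x ^ 2 * (x - 1))" for x
    by (simp add: F_def algebra_simps power2_eq_square)
  have sp: "s p = s 0 + p * a" "s (1 + p) = s 0 + d + p * b" "s 1 = s 0 + d"
    using a b by (simp_all add: d_def algebra_simps)
  have F0: "[s 0 = poly F 0] (mod (p ^ 2))" by (simp add: F)
  have F1: "[s 1 = poly F 1] (mod (p ^ 2))" by (simp add: F sp)
  have "s p - poly F p = p ^ 2 * (B - A - B * p)"
    by (simp add: F sp A_def algebra_simps power2_eq_square)
  then have Fp: "[s p = poly F p] (mod (p ^ 2))" by (simp add: cong_iff_dvd_diff)
  have "s (1 + p) - poly F (1 + p) = p ^ 2 * (- A - B * (2 + p))"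
    by (simp add: F sp B_def algebra_simps power2_eq_square)
  then have F1p: "[s (1 + p) = poly F (1 + p)] (mod (p ^ 2))" by (simp add: cong_iff_dvd_diff)
  have "[s x = poly F x] (mod (p ^ 2))" for x
  proof -
    \<comment> \<open>The first two digits of the \<open>p\<close>-adic expansion of
      \<open>x\<close>, each of them \<open>0\<close> or \<open>1\<close>.\<close>
    define y where "y = x mod p + p * (x div p mod p)"
    have "x - y = p ^ 2 * (x div p div p)"
    proof -
      have "x - y = (x - x mod p) - p * (x div p mod p)" by (simp add: y_def)
      also have "x - x mod p = p * (x div p)" by (rule minus_mod_eq_mult_div)
      also have "p * (x div p) - p * (x div p mod p) = p * (x div p - x div p mod p)"
        by (rule right_diff_distrib[symmetric])
      also have "x div p - x div p mod p = p * (x div p div p)" by (rule minus_mod_eq_mult_div)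
      finally show ?thesis by (simp only: power2_eq_square mult.assoc)
    qed
    then have xy: "[x = y] (mod (p ^ 2))" by (simp add: cong_iff_dvd_diff)
    have "y \<in> {0, 1, p, 1 + p}"
      using mod_linear_cases[OF q p, of x] mod_linear_cases[OF q p, of "x div p"]
      by (auto simp: y_def)
    then have "[s y = poly F y] (mod (p ^ 2))" using F0 F1 Fp F1p by auto
    then show ?thesis
      using compatibleD[OF s _ xy] poly_cong[OF xy, of F]
      by (meson cong_sym cong_trans dvd_refl)
  qed
  then show "\<exists>F. \<forall>x. [s x = poly F x] (mod (p ^ 2))" by blast
qed

section \<open>Obstructions to interpolation from repeated prime factors\<close>

lemma poly_second_difference_dvd:
  fixes F :: "'a :: comm_ring_1 poly"
  shows "x * y dvd poly F (x + y) - poly F x - poly F y + poly F 0"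
proof (induction F)
  case 0
  then show ?case by simp
next
  case (pCons c F)
  then obtain k where k: "poly F (x + y) = poly F x + poly F y - poly F 0 + x * y * k"
    unfolding dvd_def by (auto simp: algebra_simps)
  have "x dvd poly F x - poly F 0" "y dvd poly F y - poly F 0"
    using poly_eq_0_iff_dvd[of _ 0] by (induction F; simp)+
  then obtain u v where "poly F x = poly F 0 + x * u" "poly F y = poly F 0 + y * v"
    unfolding dvd_def by (auto simp: algebra_simps)
  \<comment> \<open>The constants cancel, and the terms \<open>z * poly F z\<close> leave
    \<open>x * (poly F y - poly F 0) + y * (poly F x - poly F 0)\<close> plus
    \<open>(x + y) * (x * y * k)\<close>.\<close>
  then have "poly (pCons c F) (x + y) - poly (pCons c F) x - poly (pCons c F) y + poly (pCons c F) 0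
      = x * y * (u + v + (x + y) * k)"
    by (simp add: k algebra_simps)
  then show ?case by simp
qed

text \<open>The map \<open>s\<close> vanishes at \<open>x\<close>, \<open>y\<close> and
  \<open>x + y\<close>, so an interpolant is \<open>0\<close> modulo \<open>p ^ e\<close> there, and
  its second difference forces the same at \<open>0\<close>. But
  \<open>s 0 = p ^ (e - 1) * b\<close> is not divisible by \<open>p ^ e\<close>.\<close>

lemma not_interpolableI:
  fixes p b x y :: "'a :: field poly"
  assumes p: "prime_elem p" and b: "\<not> p dvd b" and "e > 0"
    and xy: "\<not> p ^ e dvd x" "\<not> p ^ e dvd y" "\<not> p ^ e dvd x + y" "p ^ e dvd x * y"
  shows "\<not> interpolable (p ^ e * b)"
proof
  assume int: "interpolable (p ^ e * b)"
  obtain k where e: "e = Suc k" using \<open>e > 0\<close> by (cases e) auto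
  from p have "p \<noteq> 0" by auto
  define s where "s h = (if p ^ e dvd h then p ^ k * b else 0)" for h
  have "compatible (p ^ e * b) s"
    unfolding compatible_def
  proof (intro allI impI)
    fix d h1 h2 assume d: "d dvd p ^ e * b" and h: "[h1 = h2] (mod d)"
    show "[s h1 = s h2] (mod d)"
    proof (cases "p ^ e dvd d")
      case True
      then have "[h1 = h2] (mod (p ^ e))" using h cong_dvd_modulus by blast
      then have "p ^ e dvd h1 \<longleftrightarrow> p ^ e dvd h2" by (rule cong_dvd_iff)
      then show ?thesis by (simp add: s_def)
    next
      case False
      from d obtain c where c: "p ^ e * b = d * c" by (rule dvdE)
      \<comment> \<open>A divisor \<open>d\<close> of \<open>p ^ e * b\<close> that is no multiple
        of \<open>p ^ e\<close> lacks a factor \<open>p\<close>, hence divides both values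
        \<open>p ^ k * b\<close> and \<open>0\<close> of \<open>s\<close>.\<close>
      have "p dvd c"
      proof (rule ccontr)
        assume "\<not> p dvd c"
        moreover have "p ^ e dvd c * d" by (metis c dvd_triv_left mult.commute)
        ultimately show False using prime_power_dvd_multD[OF p] \<open>e > 0\<close> False by blast
      qed
      then obtain c' where "c = p * c'" by (rule dvdE)
      with c \<open>p \<noteq> 0\<close> have "p ^ k * b = d * c'" by (simp add: e algebra_simps)
      then have "d dvd p ^ k * b" by simp
      then show ?thesis by (auto simp: s_def cong_iff_dvd_diff)
    qed
  qed
  with int obtain F where F: "\<And>h. [s h = poly F h] (mod (p ^ e * b))"
    unfolding interpolable_def by blast
  have F': "p ^ e dvd s h - poly F h" for h
    using F[of h] dvd_mult_left unfolding cong_iff_dvd_diff by blast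
  have "p ^ e dvd poly F (x + y) - poly F x - poly F y + poly F 0"
    using xy(4) poly_second_difference_dvd dvd_trans by blast
  moreover have "p ^ e dvd poly F z" if "\<not> p ^ e dvd z" for z
    using F'[of z] that by (simp add: s_def)
  ultimately have "p ^ e dvd poly F 0"
    using xy dvd_add_right_iff[of "p ^ e" "poly F (x + y) - poly F x - poly F y" "poly F 0"]
    by (simp add: dvd_diff)
  with F'[of 0] have "p ^ e dvd s 0"
    using dvd_add[of "p ^ e" "s 0 - poly F 0" "poly F 0"] by simp
  then have "p ^ k * p dvd p ^ k * b" by (simp add: s_def e power_Suc2 del: power_Suc)
  then have "p dvd b" using \<open>p \<noteq> 0\<close> dvd_times_left_cancel_iff[of "p ^ k" p b] by simp
  with b show False by simp
qed

text \<open>\<open>CARD('a) = 2 \<and> degree p = 1\<close> says that the residue field modulo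
  \<open>p\<close> has two elements.\<close>

definition admissible :: "'a :: {finite, field} poly \<Rightarrow> bool" where
  "admissible g \<longleftrightarrow>
     (\<forall>p. prime_elem p \<longrightarrow> p ^ 2 dvd g \<longrightarrow> CARD('a) = 2 \<and> degree p = 1 \<and> \<not> p ^ 3 dvd g)"

lemma admissible_dvd:
  assumes "admissible g" "h dvd g"
  shows "admissible h"
  using assms(1) dvd_trans[OF _ assms(2)] unfolding admissible_def by blast

text \<open>Induction on the degree splits off the full power \<open>p ^ e\<close> of one prime;
  admissibility leaves \<open>e = 1\<close>, or \<open>e = 2\<close> with \<open>p\<close> linear
  over the field of two elements.\<close>

lemma admissible_imp_interpolable:
  fixes g :: "'a :: {finite, field} poly"
  assumes "g \<noteq> 0" "admissible g"
  shows "interpolable g"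
  using assms
proof (induction "degree g" arbitrary: g rule: less_induct)
  case less
  show ?case
  proof (cases "degree g = 0")
    case True
    with less.prems show ?thesis by (simp add: interpolable_unit is_unit_iff_degree)
  next
    case False
    then obtain p where p: "prime_elem p" "p dvd g" using exists_prime_elem_dvd[of g] by auto
    obtain e b where eb: "g = p ^ e * b" "\<not> p dvd b"
      using split_prime_power[OF less.prems(1) prime_elem_degree_pos[OF p(1)]] .
    have "e \<noteq> 0"
    proof
      assume "e = 0"
      with eb p(2) show False by simp
    qed
    have "b \<noteq> 0" "p \<noteq> 0" using less.prems(1) eb(1) p(1) by auto
    then have "degree b < degree g"
      using \<open>e \<noteq> 0\<close> prime_elem_degree_pos[OF p(1)]
      by (simp add: eb(1) degree_mult_eq degree_power_eq)
    moreover have "admissible b"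
      using admissible_dvd[OF less.prems(2)] eb(1) by simp
    ultimately have b: "interpolable b" using less.hyps \<open>b \<noteq> 0\<close> by simp
    have pe: "interpolable (p ^ e)"
    proof (cases "e = 1")
      case True
      then show ?thesis using interpolable_prime_elem[OF p(1)] by simp
    next
      case False
      with \<open>e \<noteq> 0\<close> have "p ^ 2 dvd g" by (simp add: eb(1) le_imp_power_dvd)
      with less.prems(2) p(1) have *: "CARD('a) = 2" "degree p = 1" "\<not> p ^ 3 dvd g"
        unfolding admissible_def by auto
      have "\<not> 3 \<le> e"
        using *(3) by (auto simp: eb(1) le_imp_power_dvd)
      with False \<open>e \<noteq> 0\<close> have "e = 2" by simp
      then show ?thesis using interpolable_linear_square[OF *(1,2)] by simp
    qed
    obtain x y where "x * p ^ e + y * b = 1" using prime_elem_power_bezout[OF p(1) eb(2)] by blast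
    then show ?thesis unfolding eb(1) by (rule interpolable_mult[OF pe b])
  qed
qed

text \<open>The residue field has an element other than \<open>0\<close> and \<open>-1\<close>: a
  constant if \<open>degree p = 1\<close>, otherwise the class of the variable. A nonzero polynomial
  of degree below \<open>degree p\<close> is no multiple of \<open>p\<close>.\<close>

lemma exists_two_translates_not_dvd:
  fixes p :: "'a :: {finite, field} poly"
  assumes "prime_elem p" "\<not> (CARD('a) = 2 \<and> degree p = 1)"
  shows "\<exists>k. \<not> p dvd k \<and> \<not> p dvd 1 + k"
proof -
  have "\<exists>k :: 'a poly. degree k < degree p \<and> k \<noteq> 0 \<and> 1 + k \<noteq> 0"
  proof (cases "degree p = 1")
    case True
    have "{0, - 1 :: 'a} \<noteq> UNIV"
    proof
      assume "{0, - 1 :: 'a} = UNIV"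
      then have "CARD('a) = card {0, - 1 :: 'a}" by simp
      with True assms(2) show False by simp
    qed
    then obtain c :: 'a where c: "c \<noteq> 0" "c \<noteq> - 1" by auto
    have "1 + c \<noteq> 0" using c(2) by (metis add_eq_0_iff)
    with c(1) True show ?thesis by (intro exI[of _ "[:c:]"]) (simp add: one_pCons)
  next
    case False
    with prime_elem_degree_pos[OF assms(1)] show ?thesis
      by (intro exI[of _ "[:0, 1:]"]) (simp add: one_pCons)
  qed
  then obtain k :: "'a poly" where k: "degree k < degree p" "k \<noteq> 0" "1 + k \<noteq> 0" by blast
  have "degree (1 + k) < degree p"
    using k(1) degree_add_le[of 1 "degree k" k] by auto
  with k show ?thesis
    using dvd_imp_degree_le[of p k] dvd_imp_degree_le[of p "1 + k"] by (intro exI[of _ k]) auto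
qed

lemma interpolable_imp_admissible:
  fixes g :: "'a :: {finite, field} poly"
  assumes "g \<noteq> 0" "interpolable g"
  shows "admissible g"
  unfolding admissible_def
proof (intro allI impI)
  fix p :: "'a poly" assume p: "prime_elem p" and p2: "p ^ 2 dvd g"
  have "p \<noteq> 0" using p by auto
  obtain e b where eb: "g = p ^ e * b" "\<not> p dvd b"
    using split_prime_power[OF assms(1) prime_elem_degree_pos[OF p]] .
  have le_e: "n \<le> e" if "p ^ n dvd g" for n
  proof (rule ccontr)
    assume "\<not> n \<le> e"
    then have "p ^ Suc e dvd p ^ e * b" using that eb(1) by (meson not_less_eq_eq power_le_dvd)
    then have "p ^ e * p dvd p ^ e * b" by (simp add: power_Suc2 del: power_Suc)
    with \<open>p \<noteq> 0\<close> eb(2) show False by simp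
  qed
  \<comment> \<open>This applies to \<open>x\<close>, \<open>y\<close> and \<open>x + y\<close>
    below: each is a power of \<open>p\<close> with exponent less than \<open>e\<close> times a
    factor not divisible by \<open>p\<close>.\<close>
  have nd: "\<not> p ^ e dvd p ^ n * u" if "n < e" "\<not> p dvd u" for n u
  proof
    assume "p ^ e dvd p ^ n * u"
    moreover have "p ^ Suc n dvd p ^ e" using that(1) by (intro le_imp_power_dvd) simp
    ultimately have "p ^ Suc n dvd p ^ n * u" using dvd_trans by blast
    then have "p ^ n * p dvd p ^ n * u" by (simp add: power_Suc2 del: power_Suc)
    with \<open>p \<noteq> 0\<close> that(2) show False by simp
  qed
  have pu: "\<not> p dvd 1" using p by (rule prime_elem_not_unit)
  have "e \<ge> 2" using le_e p2 by blast
  have e: "e < 3"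
  proof (rule ccontr)
    assume "\<not> e < 3"
    \<comment> \<open>With \<open>x = p ^ (m + 1)\<close> and \<open>y = p ^ (m + 2)\<close>, the
      sum is \<open>p ^ (m + 1) * (1 + p)\<close>, while the product has exponent
      \<open>2 * m + 3\<close>, at least \<open>e\<close>.\<close>
    then obtain m where m: "e = m + 3" using le_Suc_ex[of 3 e] by auto
    have "\<not> p dvd 1 + p" using pu by (simp add: dvd_add_left_iff)
    then have "\<not> p ^ e dvd p ^ (m + 1) + p ^ (m + 2)"
      using nd[of "m + 1" "1 + p"] by (simp add: m distrib_left distrib_right mult.commute)
    moreover have "p ^ e dvd p ^ (m + 1) * p ^ (m + 2)"
      unfolding power_add[symmetric] by (rule le_imp_power_dvd) (simp add: m)
    ultimately have "\<not> interpolable (p ^ e * b)"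
      using nd[of "m + 1" 1] nd[of "m + 2" 1] pu
      by (intro not_interpolableI[OF p eb(2), of e "p ^ (m + 1)" "p ^ (m + 2)"]) (simp_all add: m)
    with assms(2) eb(1) show False by simp
  qed
  have "CARD('a) = 2 \<and> degree p = 1"
  proof (rule ccontr)
    assume "\<not> (CARD('a) = 2 \<and> degree p = 1)"
    then obtain k where k: "\<not> p dvd k" "\<not> p dvd 1 + k"
      using exists_two_translates_not_dvd[OF p] by blast
    \<comment> \<open>With \<open>x = p\<close> and \<open>y = p * k\<close>, the sum is
      \<open>p * (1 + k)\<close>, and the product is a multiple of \<open>p ^ 2\<close>.\<close>
    have e2: "e = 2" using e \<open>e \<ge> 2\<close> by simp
    have "\<not> p ^ e dvd p + p * k"
      using nd[of 1 "1 + k"] k(2) by (simp add: e2 distrib_left)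
    moreover have "\<not> p ^ e dvd p * k" "\<not> p ^ e dvd p" using nd[of 1 k] nd[of 1 1] k(1) pu
      by (simp_all add: e2)
    moreover have "p ^ e dvd p * (p * k)"
      by (simp add: e2 power2_eq_square mult.assoc[symmetric])
    ultimately have "\<not> interpolable (p ^ e * b)"
      by (intro not_interpolableI[OF p eb(2), of e p "p * k"]) (simp_all add: e2)
    with assms(2) eb(1) show False by simp
  qed
  moreover have "\<not> p ^ 3 dvd g" using le_e e by force
  ultimately show "CARD('a) = 2 \<and> degree p = 1 \<and> \<not> p ^ 3 dvd g" by blast
qed

section \<open>Chen pairs and interpolation\<close>

lemma equiv_cong_rel: "equiv UNIV (cong_rel f)"
  unfolding cong_rel_def
  by (auto intro!: equivI refl_onI symI transI intro: cong_sym cong_trans)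

lemma residue_class_eq_iff:
  fixes a b g :: "'a :: field poly"
  shows "residue_class g a = residue_class g b \<longleftrightarrow> [a = b] (mod g)"
  using eq_equiv_class_iff[OF equiv_cong_rel, of a b g]
  by (simp add: residue_class_def cong_rel_def)

lemma residue_class_iff: "b \<in> residue_class g a \<longleftrightarrow> [a = b] (mod g)"
  by (simp add: residue_class_def cong_rel_def)

lemma residue_classes_eq_range: "residue_classes g = range (residue_class g)"
  by (auto simp: residue_classes_def residue_class_def quotient_def)

lemma reduce_residue_class:
  fixes a d g :: "'a :: field poly"
  assumes "d dvd g"
  shows "reduce d (residue_class g a) = residue_class d a"
  unfolding reduce_def
proof (rule SUP_eq_const)
  show "residue_class g a \<noteq> {}" using residue_class_iff[of a g a] by auto
next
  fix c assume "c \<in> residue_class g a"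
  then have "[a = c] (mod d)" unfolding residue_class_iff using assms by (rule cong_dvd_modulus)
  then show "residue_class d c = residue_class d a"
    unfolding residue_class_eq_iff by (rule cong_sym)
qed

lemma mod_in_representatives:
  fixes g x :: "'a :: field poly"
  assumes "g \<noteq> 0"
  shows "x mod g \<in> representatives g"
  using degree_mod_less[OF assms, of x] by (auto simp: representatives_def)

text \<open>Testing on representatives suffices: replacing \<open>x\<close> by
  \<open>x mod g\<close> changes neither \<open>x\<close> nor \<open>s x\<close> modulo a divisor of
  \<open>g\<close>.\<close>

lemma congruence_preserving_iff_compatible:
  fixes g :: "'a :: field poly"
  assumes "g \<noteq> 0" and s: "\<And>h. \<sigma> (residue_class g h) = residue_class g (s h)"
  shows "congruence_preserving g g \<sigma> \<longleftrightarrow> compatible g s"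
proof
  assume "compatible g s"
  then show "congruence_preserving g g \<sigma>"
    by (auto simp: congruence_preserving_def s reduce_residue_class residue_class_eq_iff
        dest: compatibleD)
next
  assume cp: "congruence_preserving g g \<sigma>"
  show "compatible g s"
    unfolding compatible_def
  proof (intro allI impI)
    fix d x y assume d: "d dvd g" and xy: "[x = y] (mod d)"
    have sm: "[s (h mod g) = s h] (mod d)" for h
    proof -
      have "residue_class g (h mod g) = residue_class g h"
        by (simp add: residue_class_eq_iff cong_def)
      then have "[s (h mod g) = s h] (mod g)"
        using s[of h] s[of "h mod g"] by (metis residue_class_eq_iff)
      then show ?thesis using d by (rule cong_dvd_modulus)
    qed
    have "[x mod g = y mod g] (mod d)"
      using xy d by (simp add: cong_def mod_mod_cancel)
    then have "reduce d (\<sigma> (residue_class g (x mod g))) = reduce d (\<sigma> (residue_class g (y mod g)))"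
      using cp d mod_in_representatives[OF assms(1)] unfolding congruence_preserving_def by blast
    then have "[s (x mod g) = s (y mod g)] (mod d)"
      using d by (simp add: s reduce_residue_class residue_class_eq_iff)
    then show "[s x = s y] (mod d)"
      using sm by (meson cong_sym cong_trans)
  qed
qed

lemma polynomial_function_iff:
  fixes g :: "'a :: field poly"
  assumes "g \<noteq> 0" and s: "\<And>h. \<sigma> (residue_class g h) = residue_class g (s h)"
  shows "polynomial_function g g \<sigma> \<longleftrightarrow> (\<exists>F. \<forall>x. [s x = poly F x] (mod g))"
proof
  assume "\<exists>F. \<forall>x. [s x = poly F x] (mod g)"
  then show "polynomial_function g g \<sigma>"
    by (auto simp: polynomial_function_def s residue_class_eq_iff)
next
  assume "polynomial_function g g \<sigma>"
  then obtain F where F: "\<And>h. h \<in> representatives g \<Longrightarrow> [s h = poly F h] (mod g)"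
    by (auto simp: polynomial_function_def s residue_class_eq_iff)
  have "[s x = poly F x] (mod g)" for x
  proof -
    have x: "[x = x mod g] (mod g)" by (simp add: cong_def)
    then have "residue_class g x = residue_class g (x mod g)"
      by (simp add: residue_class_eq_iff)
    then have "[s x = s (x mod g)] (mod g)"
      using s[of x] s[of "x mod g"] by (metis residue_class_eq_iff)
    also have "[s (x mod g) = poly F (x mod g)] (mod g)"
      by (rule F) (rule mod_in_representatives[OF assms(1)])
    also have "[poly F (x mod g) = poly F x] (mod g)"
      by (rule poly_cong) (rule cong_sym[OF x])
    finally show ?thesis .
  qed
  then show "\<exists>F. \<forall>x. [s x = poly F x] (mod g)" by blast
qed

text \<open>Choosing a representative of each value lifts \<open>\<sigma>\<close> to some
  \<open>s\<close>; conversely a compatible \<open>s\<close> descends to residue classes. Both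
  conditions transfer along this correspondence.\<close>

lemma Chen_pair_iff_interpolable:
  fixes g :: "'a :: field poly"
  assumes "g \<noteq> 0"
  shows "Chen_pair g g \<longleftrightarrow> interpolable g"
proof
  assume int: "interpolable g"
  show "Chen_pair g g"
    unfolding Chen_pair_def
  proof (intro allI impI)
    fix \<sigma> assume \<sigma>: "\<forall>C\<in>residue_classes g. \<sigma> C \<in> residue_classes g"
      and cp: "congruence_preserving g g \<sigma>"
    have "\<forall>h. \<exists>r. \<sigma> (residue_class g h) = residue_class g r"
      using \<sigma> by (auto simp: residue_classes_eq_range)
    then obtain s where s: "\<And>h. \<sigma> (residue_class g h) = residue_class g (s h)" by metis
    show "polynomial_function g g \<sigma>"
      using int cp congruence_preserving_iff_compatible[OF assms, of \<sigma> s, OF s]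
        polynomial_function_iff[OF assms, of \<sigma> s, OF s]
      unfolding interpolable_def by auto
  qed
next
  assume Chen: "Chen_pair g g"
  show "interpolable g"
    unfolding interpolable_def
  proof (intro allI impI)
    fix s assume cs: "compatible g s"
    \<comment> \<open>By compatibility all members of a class modulo \<open>g\<close> contribute the
      same class, so on residue classes the union is a single class.\<close>
    define \<sigma> where "\<sigma> C = (\<Union>c\<in>C. residue_class g (s c))" for C
    have s: "\<sigma> (residue_class g h) = residue_class g (s h)" for h
      unfolding \<sigma>_def
    proof (rule SUP_eq_const)
      show "residue_class g h \<noteq> {}" using residue_class_iff[of h g h] by auto
    next
      fix c assume "c \<in> residue_class g h"
      then have "[s h = s c] (mod g)"
        unfolding residue_class_iff by (rule compatibleD[OF cs dvd_refl])
      then show "residue_class g (s c) = residue_class g (s h)"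
        unfolding residue_class_eq_iff by (rule cong_sym)
    qed
    have "\<forall>C\<in>residue_classes g. \<sigma> C \<in> residue_classes g"
      by (auto simp: residue_classes_eq_range s)
    with Chen cs show "\<exists>F. \<forall>x. [s x = poly F x] (mod g)"
      using congruence_preserving_iff_compatible[OF assms, of \<sigma> s, OF s]
        polynomial_function_iff[OF assms, of \<sigma> s, OF s]
      unfolding Chen_pair_def by auto
  qed
qed

lemma Chen_pair_iff_admissible:
  fixes g :: "'a :: {finite, field} poly"
  assumes "g \<noteq> 0"
  shows "Chen_pair g g \<longleftrightarrow> admissible g"
  using assms Chen_pair_iff_interpolable admissible_imp_interpolable interpolable_imp_admissible
  by blast

section \<open>Counting squarefree polynomials\<close>

lemma squarefree_prime_square_dvd:
  fixes a b p :: "'a :: algebraic_semidom"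
  assumes "prime_elem p" "squarefree a" "p ^ 2 dvd a * b ^ 2"
  shows "p dvd b"
proof -
  have "p ^ 2 dvd a \<or> p ^ 1 dvd b ^ 2"
    using assms(3,1) by (intro prime_elem_power_dvd_cases[of p 2]) simp_all
  then show ?thesis
    using assms squarefreeD[OF assms(2)] prime_elem_not_unit
    by (auto simp: prime_elem_dvd_power_iff)
qed

text \<open>Squares of prime factors are divided out until a squarefree part remains.\<close>

lemma squarefree_decomposition_exists:
  fixes g :: "'a :: field poly"
  assumes "g \<noteq> 0"
  shows "\<exists>a b. g = a * b ^ 2 \<and> squarefree a \<and> lead_coeff b = 1"
  using assms
proof (induction "degree g" arbitrary: g rule: less_induct)
  case less
  show ?case
  proof (cases "squarefree g")
    case True
    then show ?thesis by (intro exI[of _ g] exI[of _ 1]) simp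
  next
    case False
    with less.prems obtain p where p: "prime_elem p" "p ^ 2 dvd g"
      using squarefree_iff_prime_elem by blast
    \<comment> \<open>Normalising the prime to be monic keeps \<open>b\<close> monic and moves the
      unit into \<open>a\<close>.\<close>
    define c where "c = inverse (lead_coeff p)"
    define r where "r = smult c p"
    have "p \<noteq> 0" using p(1) by auto
    then have c: "c \<noteq> 0" "lead_coeff r = 1" by (simp_all add: c_def r_def)
    have deg: "degree r > 0" using prime_elem_degree_pos[OF p(1)] c(1) by (simp add: r_def)
    have "r ^ 2 dvd g" using p(2) c(1) by (simp add: r_def smult_power smult_dvd)
    then obtain h where h: "g = r ^ 2 * h" by (rule dvdE)
    have "h \<noteq> 0" "r \<noteq> 0" using less.prems h by auto
    then have "degree h < degree g" using deg by (simp add: h degree_mult_eq degree_power_eq)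
    from less.hyps[OF this \<open>h \<noteq> 0\<close>] obtain a b
      where ab: "h = a * b ^ 2" "squarefree a" "lead_coeff b = 1" by blast
    have "g = a * (r * b) ^ 2" by (simp add: h ab(1) power_mult_distrib mult.left_commute)
    moreover have "lead_coeff (r * b) = 1" using c(2) ab(3) by (simp add: lead_coeff_mult)
    ultimately show ?thesis using ab(2) by blast
  qed
qed

text \<open>A prime factor of one of \<open>b\<close>, \<open>b'\<close> divides the other, so it
  can be cancelled from both. Equal leading coefficients, unlike monicity, survive cancelling a
  prime that is not monic.\<close>

lemma squarefree_decomposition_unique_poly:
  fixes a b a' b' :: "'a :: field poly"
  assumes "a * b ^ 2 = a' * b' ^ 2" "squarefree a" "squarefree a'"
    and "lead_coeff b = lead_coeff b'" "b \<noteq> 0"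
  shows "b = b'"
  using assms(1,4,5)
proof (induction "degree b" arbitrary: b b' rule: less_induct)
  case less
  have "b' \<noteq> 0" using less.prems(2,3) by auto
  show ?case
  proof (cases "degree b = 0")
    case True
    have "degree b' = 0"
    proof (rule ccontr)
      assume "degree b' \<noteq> 0"
      then obtain p where p: "prime_elem p" "p dvd b'" using exists_prime_elem_dvd by auto
      then have "p ^ 2 dvd a * b ^ 2" unfolding less.prems(1) by (simp add: dvd_power_same)
      then have "p dvd b" using squarefree_prime_square_dvd p(1) assms(2) by blast
      with True less.prems(3) show False
        using dvd_imp_degree_le[of p b] prime_elem_degree_pos[OF p(1)] by simp
    qed
    with True less.prems(2) show ?thesis by (metis degree_0_id)
  next
    case False
    then obtain p where p: "prime_elem p" "p dvd b" using exists_prime_elem_dvd by auto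
    then have "p ^ 2 dvd a' * b' ^ 2"
      unfolding less.prems(1)[symmetric] by (simp add: dvd_power_same)
    then have "p dvd b'" using squarefree_prime_square_dvd p(1) assms(3) by blast
    then obtain c' where c': "b' = p * c'" by (rule dvdE)
    from p(2) obtain c where c: "b = p * c" by (rule dvdE)
    have "p \<noteq> 0" "c \<noteq> 0" using p(1) less.prems(3) c by auto
    have "degree c < degree b"
      using prime_elem_degree_pos[OF p(1)] \<open>p \<noteq> 0\<close> \<open>c \<noteq> 0\<close> by (simp add: c degree_mult_eq)
    moreover have "a * c ^ 2 = a' * c' ^ 2"
    proof -
      have "p ^ 2 * (a * c ^ 2) = p ^ 2 * (a' * c' ^ 2)"
        using less.prems(1) by (simp add: c c' power_mult_distrib mult.left_commute)
      with \<open>p \<noteq> 0\<close> show ?thesis by simp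
    qed
    moreover have "lead_coeff c = lead_coeff c'"
      using less.prems(2) \<open>p \<noteq> 0\<close> by (simp add: c c' lead_coeff_mult)
    ultimately have "c = c'" using less.hyps \<open>c \<noteq> 0\<close> by blast
    then show ?thesis by (simp add: c c')
  qed
qed

text \<open>The zero polynomial also has degree \<open>0\<close>; excluding it makes the total count
  \<open>(q - 1) * q ^ n\<close> for every \<open>n\<close>, including \<open>n = 0\<close>.\<close>

definition degree_count :: "('a :: zero poly \<Rightarrow> bool) \<Rightarrow> nat \<Rightarrow> nat" where
  "degree_count P n = card {g. g \<noteq> 0 \<and> degree g = n \<and> P g}"

lemma finite_degree_subset:
  "finite {g :: 'a :: {finite, field} poly. g \<noteq> 0 \<and> degree g = n \<and> P g}"
  by (rule finite_subset[OF _ finite_degree_le[of n]]) auto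

lemma degree_count_True:
  "degree_count (\<lambda>g :: 'a :: {finite, field} poly. True) n + CARD('a) ^ n = CARD('a) ^ Suc n"
proof -
  have low: "card {g :: 'a poly. g = 0 \<or> degree g < n} = CARD('a) ^ n
      \<and> finite {g :: 'a poly. g = 0 \<or> degree g < n}"
  proof (cases n)
    case 0
    then show ?thesis by simp
  next
    case (Suc m)
    then have "{g :: 'a poly. g = 0 \<or> degree g < n} = {g. degree g \<le> m}" by auto
    then show ?thesis using card_degree_le[where 'a = 'a, of m] finite_degree_le Suc by simp
  qed
  have "{g :: 'a poly. degree g \<le> n} = {g. g \<noteq> 0 \<and> degree g = n \<and> True} \<union> {g. g = 0 \<or> degree g < n}"
    by auto
  then have "CARD('a) ^ Suc n
      = card ({g :: 'a poly. g \<noteq> 0 \<and> degree g = n \<and> True} \<union> {g. g = 0 \<or> degree g < n})"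
    using card_degree_le[where 'a = 'a, of n] by simp
  also have "\<dots> = card {g :: 'a poly. g \<noteq> 0 \<and> degree g = n \<and> True}
      + card {g :: 'a poly. g = 0 \<or> degree g < n}"
    using low finite_degree_subset[where 'a = 'a, of n "\<lambda>_. True"]
    by (intro card_Un_disjoint) auto
  finally show ?thesis using low by (simp add: degree_count_def)
qed

lemma card_monic_degree:
  "card {b :: 'a :: {finite, field} poly. lead_coeff b = 1 \<and> degree b = k} = CARD('a) ^ k"
proof (induction k)
  case 0
  have "{b :: 'a poly. lead_coeff b = 1 \<and> degree b = 0} = {1}"
    by (auto simp: one_pCons elim: degree_eq_zeroE)
  then show ?case by simp
next
  case (Suc k)
  have eq: "{b :: 'a poly. lead_coeff b = 1 \<and> degree b = Suc k} =
      (\<lambda>(c, b). pCons c b) ` (UNIV \<times> {b. lead_coeff b = 1 \<and> degree b = k})"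
  proof (intro equalityI subsetI)
    fix b :: "'a poly" assume b: "b \<in> {b. lead_coeff b = 1 \<and> degree b = Suc k}"
    obtain c h where ch: "b = pCons c h" by (rule pCons_cases)
    with b have "(c, h) \<in> UNIV \<times> {b. lead_coeff b = 1 \<and> degree b = k}"
      by (auto split: if_splits)
    with ch show "b \<in> (\<lambda>(c, b). pCons c b) ` (UNIV \<times> {b. lead_coeff b = 1 \<and> degree b = k})"
      by force
  qed auto
  have "inj_on (\<lambda>(c, b). pCons c b) (UNIV \<times> {b :: 'a poly. lead_coeff b = 1 \<and> degree b = k})"
    by (auto simp: inj_on_def)
  then show ?case unfolding eq using Suc by (simp add: card_image card_cartesian_product)
qed

text \<open>The summand \<open>k\<close> counts the products \<open>a * b ^ 2\<close> with
  \<open>b\<close> monic of degree \<open>k\<close>; existence and uniqueness of this decomposition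
  make \<open>f\<close> a bijection from \<open>D\<close>.\<close>

lemma degree_count_eq_sum_squarefree:
  "degree_count (\<lambda>g :: 'a :: {finite, field} poly. True) n
     = (\<Sum>k\<le>n div 2. degree_count (squarefree :: 'a poly \<Rightarrow> bool) (n - 2 * k) * CARD('a) ^ k)"
proof -
  define S where "S m = {a :: 'a poly. a \<noteq> 0 \<and> degree a = m \<and> squarefree a}" for m
  define M where "M k = {b :: 'a poly. lead_coeff b = 1 \<and> degree b = k}" for k
  define D where "D = (SIGMA k:{..n div 2}. S (n - 2 * k) \<times> M k)"
  define f where "f = (\<lambda>(k :: nat, a :: 'a poly, b). a * b ^ 2)"
  have fin: "finite (S m)" "finite (M m)" for m
    unfolding S_def M_def
    by (rule finite_subset[OF _ finite_degree_le[of m]]; auto)+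
  have "inj_on f D"
  proof (rule inj_onI)
    fix u v assume "u \<in> D" "v \<in> D" and eq: "f u = f v"
    obtain k a b where u: "u = (k, a, b)" by (cases u)
    obtain k' a' b' where v: "v = (k', a', b')" by (cases v)
    have D: "squarefree a" "lead_coeff b = 1" "degree b = k"
      "squarefree a'" "lead_coeff b' = 1" "degree b' = k'"
      using \<open>u \<in> D\<close> \<open>v \<in> D\<close> by (auto simp: u v D_def S_def M_def)
    have "b \<noteq> 0" using D(2) by auto
    have ab: "a * b ^ 2 = a' * b' ^ 2" using eq by (simp add: f_def u v)
    have "b = b'"
      using squarefree_decomposition_unique_poly[OF ab D(1) D(4)] D(2,5) \<open>b \<noteq> 0\<close> by simp
    moreover from this have "a = a'" using ab \<open>b \<noteq> 0\<close> by simp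
    ultimately show "u = v" using D by (simp add: u v)
  qed
  moreover have "f ` D = {g. g \<noteq> 0 \<and> degree g = n \<and> True}"
  proof (intro equalityI subsetI)
    fix g assume "g \<in> f ` D"
    then obtain k a b where k: "k \<le> n div 2" and a: "a \<noteq> 0" "degree a = n - 2 * k"
      and b: "lead_coeff b = 1" "degree b = k" and g: "g = a * b ^ 2"
      by (auto simp: D_def f_def S_def M_def)
    have "b \<noteq> 0" using b(1) by auto
    then have "degree g = degree a + 2 * degree b"
      using a(1) by (simp add: g degree_mult_eq degree_power_eq)
    then show "g \<in> {g. g \<noteq> 0 \<and> degree g = n \<and> True}"
      using a b(2) k \<open>b \<noteq> 0\<close> by (simp add: g)
  next
    fix g :: "'a poly" assume "g \<in> {g. g \<noteq> 0 \<and> degree g = n \<and> True}"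
    then have g: "g \<noteq> 0" "degree g = n" by auto
    obtain a b where ab: "g = a * b ^ 2" "squarefree a" "lead_coeff b = 1"
      using squarefree_decomposition_exists[OF g(1)] by blast
    have "a \<noteq> 0" "b \<noteq> 0" using g(1) ab(1) by auto
    then have deg: "n = degree a + 2 * degree b"
      using g(2) by (simp add: ab(1) degree_mult_eq degree_power_eq)
    then have "(degree b, a, b) \<in> D"
      using \<open>a \<noteq> 0\<close> ab by (auto simp: D_def S_def M_def)
    then show "g \<in> f ` D"
      by (rule rev_image_eqI) (simp add: f_def ab(1))
  qed
  ultimately have "degree_count (\<lambda>g :: 'a poly. True) n = card D"
    unfolding degree_count_def by (metis card_image)
  also have "\<dots> = (\<Sum>k\<le>n div 2. card (S (n - 2 * k) \<times> M k))"
    unfolding D_def by (rule card_SigmaI) (use fin in auto)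
  also have "\<dots> = (\<Sum>k\<le>n div 2. degree_count (squarefree :: 'a poly \<Rightarrow> bool) (n - 2 * k) * CARD('a) ^ k)"
    by (simp only: card_cartesian_product S_def M_def degree_count_def card_monic_degree)
  finally show ?thesis .
qed

text \<open>In the sum for \<open>n + 2\<close> the term \<open>k = 0\<close> is the squarefree
  count, and the terms \<open>Suc k\<close> are \<open>CARD('a)\<close> times the terms of the sum
  for \<open>n\<close>.\<close>

lemma degree_count_squarefree:
  "degree_count (squarefree :: 'a :: {finite, field} poly \<Rightarrow> bool) (Suc (Suc n))
     + CARD('a) * degree_count (\<lambda>g :: 'a poly. True) n
   = degree_count (\<lambda>g :: 'a poly. True) (Suc (Suc n))"
proof -
  have "degree_count (\<lambda>g :: 'a poly. True) (Suc (Suc n))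
      = degree_count (squarefree :: 'a poly \<Rightarrow> bool) (Suc (Suc n)) +
        (\<Sum>k\<le>n div 2. degree_count (squarefree :: 'a poly \<Rightarrow> bool) (n - 2 * k) * CARD('a) ^ Suc k)"
    unfolding degree_count_eq_sum_squarefree[of "Suc (Suc n)"]
    by (simp add: sum.atMost_Suc_shift del: sum.atMost_Suc)
  then show ?thesis
    by (simp add: degree_count_eq_sum_squarefree[of n] sum_distrib_left mult_ac)
qed

section \<open>Densities\<close>

text \<open>Normalised by \<open>q ^ n\<close>, not by the number \<open>(q - 1) * q ^ n\<close> of
  polynomials of degree \<open>n\<close>: the set of all polynomials gets
  \<open>q - 1\<close>.\<close>

definition has_density :: "('a :: {finite, field} poly \<Rightarrow> bool) \<Rightarrow> real \<Rightarrow> bool" where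
  "has_density P L \<longleftrightarrow> (\<lambda>n. real (degree_count P n) / real CARD('a) ^ n) \<longlonglongrightarrow> L"

text \<open>\<open>L / (1 + a)\<close> is the fixed point of the limiting recurrence, and the
  deviation \<open>y\<close> from it contracts because \<open>\<bar>a\<bar> < 1\<close>.\<close>

lemma tendsto_linear_recurrence:
  fixes x :: "nat \<Rightarrow> real"
  assumes lim: "(\<lambda>n. x (Suc n) + a * x n) \<longlonglongrightarrow> L" and a: "\<bar>a\<bar> < 1"
  shows "x \<longlonglongrightarrow> L / (1 + a)"
proof -
  define y where "y n = x n - L / (1 + a)" for n
  have "1 + a \<noteq> 0" using a by auto
  have "L / (1 + a) + a * (L / (1 + a)) = (1 + a) * (L / (1 + a))" by (simp only: distrib_right mult_1)
  also have "\<dots> = L" using \<open>1 + a \<noteq> 0\<close> by simp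
  finally have "L / (1 + a) + a * (L / (1 + a)) = L" .
  then have "(\<lambda>n. y (Suc n) + a * y n) = (\<lambda>n. (x (Suc n) + a * x n) - L)"
    by (simp add: y_def algebra_simps)
  then have y: "(\<lambda>n. y (Suc n) + a * y n) \<longlonglongrightarrow> 0"
    using tendsto_diff[OF lim tendsto_const[of L]] by simp
  have "y \<longlonglongrightarrow> 0"
  proof (rule LIMSEQ_I)
    fix e :: real assume "e > 0"
    then have "e / 2 * (1 - \<bar>a\<bar>) > 0" using a by simp
    from LIMSEQ_D[OF y this] obtain N
      where N: "\<And>n. n \<ge> N \<Longrightarrow> \<bar>y (Suc n) + a * y n\<bar> < e / 2 * (1 - \<bar>a\<bar>)" by auto
    \<comment> \<open>Each step multiplies the old bound by \<open>\<bar>a\<bar>\<close> and adds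
      less than \<open>e / 2 * (1 - \<bar>a\<bar>)\<close>, which tops
      \<open>\<bar>a\<bar> * (e / 2)\<close> up to exactly \<open>e / 2\<close>.\<close>
    have bound: "\<bar>y (N + k)\<bar> \<le> \<bar>a\<bar> ^ k * \<bar>y N\<bar> + e / 2" for k
    proof (induction k)
      case 0
      then show ?case using \<open>e > 0\<close> by simp
    next
      case (Suc k)
      have "\<bar>y (Suc (N + k))\<bar> \<le> \<bar>y (Suc (N + k)) + a * y (N + k)\<bar> + \<bar>a\<bar> * \<bar>y (N + k)\<bar>"
        unfolding abs_mult[symmetric] by linarith
      also have "\<dots> \<le> e / 2 * (1 - \<bar>a\<bar>) + \<bar>a\<bar> * (\<bar>a\<bar> ^ k * \<bar>y N\<bar> + e / 2)"
        using N[of "N + k"] mult_left_mono[OF Suc abs_ge_zero[of a]] by simp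
      also have "\<dots> = \<bar>a\<bar> ^ Suc k * \<bar>y N\<bar> + e / 2" by (simp add: field_simps)
      finally show ?case by simp
    qed
    have "(\<lambda>k. \<bar>a\<bar> ^ k * \<bar>y N\<bar>) \<longlonglongrightarrow> 0"
      using a by (intro tendsto_mult_left_zero LIMSEQ_power_zero) simp
    from LIMSEQ_D[OF this, of "e / 2"] obtain K
      where K: "\<And>k. k \<ge> K \<Longrightarrow> \<bar>a\<bar> ^ k * \<bar>y N\<bar> < e / 2" using \<open>e > 0\<close> by (auto simp: abs_mult)
    have "norm (y n - 0) < e" if "n \<ge> N + K" for n
    proof -
      have "n = N + (n - N)" "n - N \<ge> K" using that by simp_all
      then show ?thesis using bound[of "n - N"] K[of "n - N"] by simp
    qed
    then show "\<exists>n0. \<forall>n\<ge>n0. norm (y n - 0) < e" by blast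
  qed
  then have "(\<lambda>n. y n + L / (1 + a)) \<longlonglongrightarrow> 0 + L / (1 + a)" by (intro tendsto_add tendsto_const)
  then show ?thesis by (simp add: y_def)
qed

text \<open>The cumulative count grows by the count in degree \<open>m + 1\<close>; divided by
  \<open>q ^ (m + 1)\<close> this is a linear recurrence with coefficient
  \<open>- 1 / q\<close>.\<close>

lemma has_density_cumulative:
  fixes P :: "'a :: {finite, field} poly \<Rightarrow> bool"
  assumes "has_density P L"
  shows "(\<lambda>m. real (card {g. 1 \<le> degree g \<and> degree g \<le> m \<and> P g}) / real CARD('a) ^ m)
    \<longlonglongrightarrow> L / (1 - 1 / real CARD('a))"
proof -
  let ?q = "real CARD('a)"
  have q: "CARD('a) > 1"
    using card_mono[of UNIV "{0, 1 :: 'a}"] by simp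
  define x where "x m = real (card {g. 1 \<le> degree g \<and> degree g \<le> m \<and> P g}) / ?q ^ m" for m
  have step: "x (Suc m) + (- 1 / ?q) * x m = real (degree_count P (Suc m)) / ?q ^ Suc m" for m
  proof -
    have "{g. 1 \<le> degree g \<and> degree g \<le> Suc m \<and> P g} =
        {g. 1 \<le> degree g \<and> degree g \<le> m \<and> P g} \<union> {g. g \<noteq> 0 \<and> degree g = Suc m \<and> P g}"
      by auto
    moreover have "finite {g. 1 \<le> degree g \<and> degree g \<le> m \<and> P g}"
      by (rule finite_subset[OF _ finite_degree_le[of m]]) auto
    ultimately have "card {g. 1 \<le> degree g \<and> degree g \<le> Suc m \<and> P g} =
        card {g. 1 \<le> degree g \<and> degree g \<le> m \<and> P g} + degree_count P (Suc m)"
      unfolding degree_count_def using finite_degree_subset[of "Suc m" P]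
      by (simp add: card_Un_disjoint disjoint_iff)
    then show ?thesis using q by (simp add: x_def field_simps)
  qed
  have "(\<lambda>m. x (Suc m) + (- 1 / ?q) * x m) \<longlonglongrightarrow> L"
    unfolding step using assms unfolding has_density_def by (rule LIMSEQ_Suc)
  then have "x \<longlonglongrightarrow> L / (1 + - 1 / ?q)"
    by (rule tendsto_linear_recurrence) (use q in simp)
  then show ?thesis by (simp add: x_def[abs_def])
qed

section \<open>Densities of all and of squarefree polynomials\<close>

lemma has_density_True:
  "has_density (\<lambda>g :: 'a :: {finite, field} poly. True) (real CARD('a) - 1)"
proof -
  have "real (degree_count (\<lambda>g :: 'a poly. True) n) = (real CARD('a) - 1) * real CARD('a) ^ n" for n
    using arg_cong[OF degree_count_True[where 'a = 'a, of n], of real]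
    by (simp add: algebra_simps)
  then show ?thesis unfolding has_density_def by simp
qed

lemma has_density_squarefree:
  "has_density (squarefree :: 'a :: {finite, field} poly \<Rightarrow> bool) ((real CARD('a) - 1) ^ 2 / real CARD('a))"
proof -
  let ?q = "real CARD('a)"
  have tot: "real (degree_count (\<lambda>g :: 'a poly. True) n) = (?q - 1) * ?q ^ n" for n
    using arg_cong[OF degree_count_True[where 'a = 'a, of n], of real]
    by (simp add: algebra_simps)
  \<comment> \<open>From degree \<open>2\<close> on the quotient is constant:
    \<open>(q - 1) - (q - 1) / q\<close>.\<close>
  have "real (degree_count (squarefree :: 'a poly \<Rightarrow> bool) (Suc (Suc n))) / ?q ^ Suc (Suc n)
      = (?q - 1) ^ 2 / ?q" for n
    using arg_cong[OF degree_count_squarefree[where 'a = 'a, of n], of real]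
    by (simp add: tot field_simps power2_eq_square)
  then have "(\<lambda>n. real (degree_count (squarefree :: 'a poly \<Rightarrow> bool) (n + 2)) / ?q ^ (n + 2))
      \<longlonglongrightarrow> (?q - 1) ^ 2 / ?q"
    by simp
  then show ?thesis unfolding has_density_def by (rule LIMSEQ_offset)
qed

lemma has_density_cong:
  assumes "\<And>g. g \<noteq> 0 \<Longrightarrow> P g \<longleftrightarrow> Q g"
  shows "has_density P L \<longleftrightarrow> has_density Q L"
proof -
  have "degree_count P n = degree_count Q n" for n
    unfolding degree_count_def using assms by (intro arg_cong[of _ _ card]) auto
  then show ?thesis by (simp add: has_density_def)
qed

text \<open>Either \<open>p\<close> does not divide \<open>g\<close>, or \<open>g = p * h\<close>
  with \<open>h\<close> of degree one less and not divisible by \<open>p ^ j\<close>;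
  \<open>Z\<close> is insensitive to the factor \<open>p\<close>.\<close>

lemma degree_count_split_linear:
  fixes p :: "'a :: {finite, field} poly"
  assumes p: "degree p = 1" and Z: "\<And>g. Z (p * g) \<longleftrightarrow> Z g"
  shows "degree_count (\<lambda>g. Z g \<and> \<not> p ^ Suc j dvd g) (Suc n)
    = degree_count (\<lambda>g. Z g \<and> \<not> p dvd g) (Suc n) + degree_count (\<lambda>g. Z g \<and> \<not> p ^ j dvd g) n"
proof -
  let ?A = "{g. g \<noteq> 0 \<and> degree g = Suc n \<and> (Z g \<and> \<not> p dvd g)}"
  let ?B = "{g. g \<noteq> 0 \<and> degree g = n \<and> (Z g \<and> \<not> p ^ j dvd g)}"
  have "p \<noteq> 0" using p by auto
  have "{g. g \<noteq> 0 \<and> degree g = Suc n \<and> (Z g \<and> \<not> p ^ Suc j dvd g)} = ?A \<union> (*) p ` ?B"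
  proof (intro equalityI subsetI)
    fix g assume g: "g \<in> {g. g \<noteq> 0 \<and> degree g = Suc n \<and> (Z g \<and> \<not> p ^ Suc j dvd g)}"
    show "g \<in> ?A \<union> (*) p ` ?B"
    proof (cases "p dvd g")
      case False
      with g show ?thesis by simp
    next
      case True
      then obtain h where h: "g = p * h" by (rule dvdE)
      with g p \<open>p \<noteq> 0\<close> have "h \<in> ?B" by (auto simp: degree_mult_eq Z)
      with h show ?thesis by blast
    qed
  next
    fix g assume "g \<in> ?A \<union> (*) p ` ?B"
    then show "g \<in> {g. g \<noteq> 0 \<and> degree g = Suc n \<and> (Z g \<and> \<not> p ^ Suc j dvd g)}"
      using p \<open>p \<noteq> 0\<close> by (auto simp: degree_mult_eq Z dest: dvd_mult_left)
  qed
  moreover have "inj_on ((*) p) ?B" using \<open>p \<noteq> 0\<close> by (simp add: inj_on_def)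
  moreover have "?A \<inter> (*) p ` ?B = {}" by auto
  ultimately show ?thesis
    unfolding degree_count_def
    using finite_degree_subset[of "Suc n" "\<lambda>g. Z g \<and> \<not> p dvd g"]
      finite_degree_subset[of n "\<lambda>g. Z g \<and> \<not> p ^ j dvd g"]
    by (simp add: card_Un_disjoint card_image)
qed

text \<open>With \<open>x j\<close> the normalised count for \<open>p ^ j\<close>, splitting gives
  \<open>x (j + 1) = x 1 + x j / 2\<close> in the limit. Thus \<open>x 1\<close> tends to
  \<open>2 / 3 * L\<close> and \<open>x 3\<close> to \<open>2 / 3 * L + 1 / 2 * L\<close>.\<close>

lemma has_density_not_cube_dvd:
  fixes p :: "'a :: {finite, field} poly"
  assumes q: "CARD('a) = 2" and p: "degree p = 1" and Z: "\<And>g. Z (p * g) \<longleftrightarrow> Z g"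
    and dens: "has_density (\<lambda>g. Z g \<and> \<not> p ^ 2 dvd g) L"
  shows "has_density (\<lambda>g. Z g \<and> \<not> p ^ 3 dvd g) (7 / 6 * L)"
proof -
  define x where "x j n = real (degree_count (\<lambda>g. Z g \<and> \<not> p ^ j dvd g) n) / 2 ^ n" for j n
  have step: "x (Suc j) (Suc n) = x 1 (Suc n) + 1 / 2 * x j n" for j n
    using degree_count_split_linear[of p Z j n, OF p Z] by (simp add: x_def field_simps)
  have 2: "x 2 \<longlonglongrightarrow> L" using dens by (simp add: has_density_def q x_def[abs_def])
  have "(\<lambda>n. x 1 (Suc n) + 1 / 2 * x 1 n) = (\<lambda>n. x 2 (Suc n))"
    using step[of 1] by (simp add: numeral_2_eq_2)
  with LIMSEQ_Suc[OF 2] have "(\<lambda>n. x 1 (Suc n) + 1 / 2 * x 1 n) \<longlonglongrightarrow> L" by simp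
  \<comment> \<open>Convergence of \<open>x 1\<close> is not given; it follows from that of
    \<open>x 2\<close> by reading the case \<open>j = 1\<close> as a recurrence for
    \<open>x 1\<close>.\<close>
  then have 1: "x 1 \<longlonglongrightarrow> L / (1 + 1 / 2)" by (rule tendsto_linear_recurrence) simp
  have "(\<lambda>n. x 1 (Suc n) + 1 / 2 * x 2 n) \<longlonglongrightarrow> L / (1 + 1 / 2) + 1 / 2 * L"
    by (intro tendsto_add tendsto_mult tendsto_const 2 LIMSEQ_Suc[OF 1])
  moreover have "(\<lambda>n. x 1 (Suc n) + 1 / 2 * x 2 n) = (\<lambda>n. x 3 (Suc n))"
    using step[of 2] by (simp add: numeral_3_eq_3 numeral_2_eq_2)
  ultimately have "(\<lambda>n. x 3 (Suc n)) \<longlonglongrightarrow> 7 / 6 * L" by simp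
  then have "x 3 \<longlonglongrightarrow> 7 / 6 * L" by (rule LIMSEQ_imp_Suc)
  then show ?thesis by (simp add: has_density_def q x_def[abs_def])
qed

section \<open>The density of Chen pairs\<close>

lemma prime_elem_power_dvd_mult_iff:
  fixes p r :: "'a :: algebraic_semidom"
  assumes "prime_elem r" "\<not> r dvd p" "k > 0"
  shows "r ^ k dvd p * g \<longleftrightarrow> r ^ k dvd g"
proof
  assume "r ^ k dvd p * g"
  from assms(1) this assms(3,2) show "r ^ k dvd g" by (rule prime_power_dvd_multD)
qed (rule dvd_mult)

text \<open>Over the field of two elements this is the common part of squarefreeness and
  admissibility for \<open>g \<noteq> 0\<close>; they differ only at linear primes.\<close>

definition nonlinear_squarefree :: "'a :: field poly \<Rightarrow> bool" where
  "nonlinear_squarefree g \<longleftrightarrow> (\<forall>p. prime_elem p \<longrightarrow> degree p \<noteq> 1 \<longrightarrow> \<not> p ^ 2 dvd g)"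

lemma nonlinear_squarefree_mult_linear:
  fixes p :: "'a :: field poly"
  assumes "degree p = 1"
  shows "nonlinear_squarefree (p * g) \<longleftrightarrow> nonlinear_squarefree g"
proof -
  have "r ^ 2 dvd p * g \<longleftrightarrow> r ^ 2 dvd g" if "prime_elem r" "degree r \<noteq> 1" for r
  proof (rule prime_elem_power_dvd_mult_iff[OF that(1)])
    have "p \<noteq> 0" using assms by auto
    with assms that show "\<not> r dvd p"
      using dvd_imp_degree_le[of r p] prime_elem_degree_pos[OF that(1)] by auto
  qed simp
  then show ?thesis unfolding nonlinear_squarefree_def by blast
qed

lemma degree_1E:
  fixes p :: "'a :: field poly"
  assumes "degree p = 1"
  obtains a b where "p = [:a, b:]" "b \<noteq> 0"
proof -
  obtain a r where p: "p = pCons a r" by (rule pCons_cases)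
  with assms have "degree r = 0" "r \<noteq> 0" by (auto split: if_splits)
  then obtain b where "r = [:b:]" by (elim degree_eq_zeroE)
  with p \<open>r \<noteq> 0\<close> that show ?thesis by simp
qed

lemma degree_1_cases:
  fixes p :: "'a :: {finite, field} poly"
  assumes "CARD('a) = 2" "degree p = 1"
  shows "p = [:0, 1:] \<or> p = [:1, 1:]"
proof -
  obtain a b where p: "p = [:a, b:]" and "b \<noteq> 0" using assms(2) by (elim degree_1E)
  moreover have "a \<in> {0, 1}" "b \<in> {0, 1}" using UNIV_eq_0_1[OF assms(1)] by auto
  ultimately show ?thesis using p by auto
qed

lemma prime_elem_linear:
  fixes p :: "'a :: field poly"
  assumes "degree p = 1"
  shows "prime_elem p"
  using assms by (elim degree_1E) (simp add: prime_elem_linear_field_poly)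

lemma squarefree_iff_linear_factors:
  fixes g :: "'a :: {finite, field} poly"
  assumes "CARD('a) = 2" "g \<noteq> 0"
  shows "squarefree g \<longleftrightarrow> nonlinear_squarefree g \<and> \<not> [:1, 1:] ^ 2 dvd g \<and> \<not> [:0, 1:] ^ 2 dvd g"
proof -
  have "prime_elem [:0, 1 :: 'a:]" "prime_elem [:1, 1 :: 'a:]"
    by (simp_all add: prime_elem_linear)
  then show ?thesis
    unfolding squarefree_iff_prime_elem nonlinear_squarefree_def
    using degree_1_cases[OF assms(1)] assms(2) by metis
qed

lemma admissible_iff_linear_factors:
  fixes g :: "'a :: {finite, field} poly"
  assumes q: "CARD('a) = 2"
  shows "admissible g \<longleftrightarrow> nonlinear_squarefree g \<and> \<not> [:0, 1:] ^ 3 dvd g \<and> \<not> [:1, 1:] ^ 3 dvd g"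
proof
  assume adm: "admissible g"
  have "\<not> p ^ 3 dvd g" if "degree p = 1" for p
    using adm prime_elem_linear[OF that] power_le_dvd[of p 3 g 2]
    unfolding admissible_def by auto
  with adm show "nonlinear_squarefree g \<and> \<not> [:0, 1:] ^ 3 dvd g \<and> \<not> [:1, 1:] ^ 3 dvd g"
    unfolding admissible_def nonlinear_squarefree_def by auto
next
  assume "nonlinear_squarefree g \<and> \<not> [:0, 1:] ^ 3 dvd g \<and> \<not> [:1, 1:] ^ 3 dvd g"
  then show "admissible g"
    unfolding admissible_def nonlinear_squarefree_def using degree_1_cases[OF q] q by metis
qed

text \<open>Starting from the squarefree density \<open>1 / 2\<close>, the condition is relaxed
  first at \<open>s\<close>, then at \<open>t\<close>, giving \<open>7 / 12\<close> and
  \<open>49 / 72\<close>. In each round \<open>Z\<close> holds the condition at the other prime,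
  which multiplication by the current one preserves.\<close>

lemma has_density_admissible_2:
  assumes q: "CARD('a :: {finite, field}) = 2"
  shows "has_density (admissible :: 'a poly \<Rightarrow> bool) (49 / 72)"
proof -
  define s t :: "'a poly" where "s = [:0, 1:]" and "t = [:1, 1:]"
  have st: "degree s = 1" "degree t = 1" by (simp_all add: s_def t_def)
  have "poly t 0 \<noteq> 0" by (simp add: t_def)
  then have "\<not> s dvd t" using poly_eq_0_iff_dvd[of t 0] by (simp add: s_def)
  have "poly s (- 1) \<noteq> 0" by (simp add: s_def)
  then have "\<not> t dvd s" using poly_eq_0_iff_dvd[of s "- 1"] by (simp add: t_def)
  let ?N = "nonlinear_squarefree :: 'a poly \<Rightarrow> bool"
  have Zs: "?N (s * g) \<and> \<not> t ^ 2 dvd s * g \<longleftrightarrow> ?N g \<and> \<not> t ^ 2 dvd g" for g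
    by (simp add: nonlinear_squarefree_mult_linear[OF st(1)]
        prime_elem_power_dvd_mult_iff[OF prime_elem_linear[OF st(2)] \<open>\<not> t dvd s\<close>])
  have Zt: "?N (t * g) \<and> \<not> s ^ 3 dvd t * g \<longleftrightarrow> ?N g \<and> \<not> s ^ 3 dvd g" for g
    by (simp add: nonlinear_squarefree_mult_linear[OF st(2)]
        prime_elem_power_dvd_mult_iff[OF prime_elem_linear[OF st(1)] \<open>\<not> s dvd t\<close>])
  have "has_density (squarefree :: 'a poly \<Rightarrow> bool) (1 / 2)"
    using has_density_squarefree[where 'a = 'a] by (simp add: q)
  moreover have "has_density (squarefree :: 'a poly \<Rightarrow> bool) (1 / 2)
      \<longleftrightarrow> has_density (\<lambda>g. (?N g \<and> \<not> t ^ 2 dvd g) \<and> \<not> s ^ 2 dvd g) (1 / 2)"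
    by (rule has_density_cong)
      (simp add: squarefree_iff_linear_factors[OF q, folded s_def t_def] conj_assoc)
  ultimately have "has_density (\<lambda>g. (?N g \<and> \<not> t ^ 2 dvd g) \<and> \<not> s ^ 2 dvd g) (1 / 2)" by blast
  from has_density_not_cube_dvd[OF q st(1), of "\<lambda>g. ?N g \<and> \<not> t ^ 2 dvd g", OF Zs this]
  have "has_density (\<lambda>g. (?N g \<and> \<not> t ^ 2 dvd g) \<and> \<not> s ^ 3 dvd g) (7 / 12)" by simp
  moreover have "(\<lambda>g. (?N g \<and> \<not> t ^ 2 dvd g) \<and> \<not> s ^ 3 dvd g)
      = (\<lambda>g. (?N g \<and> \<not> s ^ 3 dvd g) \<and> \<not> t ^ 2 dvd g)"
    by blast
  ultimately have "has_density (\<lambda>g. (?N g \<and> \<not> s ^ 3 dvd g) \<and> \<not> t ^ 2 dvd g) (7 / 12)" by simp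
  from has_density_not_cube_dvd[OF q st(2), of "\<lambda>g. ?N g \<and> \<not> s ^ 3 dvd g", OF Zt this]
  have "has_density (\<lambda>g. (?N g \<and> \<not> s ^ 3 dvd g) \<and> \<not> t ^ 3 dvd g) (49 / 72)" by simp
  moreover have "admissible = (\<lambda>g. (?N g \<and> \<not> s ^ 3 dvd g) \<and> \<not> t ^ 3 dvd g)"
    by (intro ext) (simp only: admissible_iff_linear_factors[OF q, folded s_def t_def] conj_assoc)
  ultimately show ?thesis by simp
qed

lemma has_density_Chen_pair:
  "has_density (\<lambda>g :: 'a :: {finite, field} poly. Chen_pair g g)
     (if CARD('a) = 2 then 49 / 72 else (real CARD('a) - 1) ^ 2 / real CARD('a))"
proof (cases "CARD('a) = 2")
  case True
  then show ?thesis
    using has_density_admissible_2[OF True]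
      has_density_cong[of "\<lambda>g :: 'a poly. Chen_pair g g" admissible] Chen_pair_iff_admissible
    by auto
next
  case False
  \<comment> \<open>For \<open>CARD('a) \<noteq> 2\<close> admissibility forbids every prime
    square.\<close>
  have "Chen_pair g g \<longleftrightarrow> squarefree g" if "g \<noteq> 0" for g :: "'a poly"
    using that False
    by (auto simp: Chen_pair_iff_admissible admissible_def squarefree_iff_prime_elem)
  with False show ?thesis
    using has_density_squarefree[where 'a = 'a]
      has_density_cong[of "\<lambda>g :: 'a poly. Chen_pair g g" squarefree]
    by auto
qed

theorem theorem1p10:
  fixes q :: nat
  assumes "q = CARD('a::{finite, field})"
  shows "(\<lambda>m::nat. real (card {g :: 'a poly. 1 \<le> degree g \<and> degree g \<le> m \<and> Chen_pair g g})
              / real (card {g :: 'a poly. 1 \<le> degree g \<and> degree g \<le> m}))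
         \<longlonglongrightarrow> (if q = 2 then 49 / 72 else (real q - 1) / real q)"
proof -
  have q: "real q > 1"
    using card_mono[of UNIV "{0, 1 :: 'a}"] assms by simp
  define L where "L = (if q = 2 then 49 / 72 else (real q - 1) ^ 2 / real q)"
  let ?C = "\<lambda>m. real (card {g :: 'a poly. 1 \<le> degree g \<and> degree g \<le> m \<and> Chen_pair g g})"
  let ?T = "\<lambda>m. real (card {g :: 'a poly. 1 \<le> degree g \<and> degree g \<le> m})"
  have C: "(\<lambda>m. ?C m / real q ^ m) \<longlonglongrightarrow> L / (1 - 1 / real q)"
    using has_density_cumulative[OF has_density_Chen_pair[where 'a = 'a]]
    unfolding L_def assms .
  have T: "(\<lambda>m. ?T m / real q ^ m) \<longlonglongrightarrow> (real q - 1) / (1 - 1 / real q)"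
    using has_density_cumulative[OF has_density_True[where 'a = 'a]] by (simp add: assms)
  have "(\<lambda>m. (?C m / real q ^ m) / (?T m / real q ^ m))
      \<longlonglongrightarrow> L / (1 - 1 / real q) / ((real q - 1) / (1 - 1 / real q))"
    by (rule tendsto_divide[OF C T]) (use q in simp)
  moreover have "(\<lambda>m. (?C m / real q ^ m) / (?T m / real q ^ m)) = (\<lambda>m. ?C m / ?T m)"
    using q by auto
  \<comment> \<open>The factor \<open>1 - 1 / real q\<close> cancels, and dividing by the total
    density \<open>real q - 1\<close>, which is \<open>1\<close> for \<open>q = 2\<close>, undoes
    the normalisation.\<close>
  moreover have "L / (1 - 1 / real q) / ((real q - 1) / (1 - 1 / real q))
      = (if q = 2 then 49 / 72 else (real q - 1) / real q)"
    using q by (simp add: L_def power2_eq_square)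
  ultimately show ?thesis by (simp only:)
qed

end
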